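(* For every integer $k\ge 0$, $r_k=a_{k,k}$.
   Context: For nonnegative integers $p,q$, let $a_{p,q}$ be the number of ways to partition a set consisting of $p$ marked points on a line and $q$ marked points on a parallel line into pairs, joining the two points of each pair by a straight segment, such that no two segments have a common point (in particular, no endpoint lies on another segment). We have $a_{0,0}=1$. Consider lattice paths consisting of steps of four kinds, each with a cost: - an up step $(1,1)$ of cost $3/2$; - a down step $(1,-1)$ of cost $3/2$; - a "cheap" horizontal step $(1,0)$ of cost $1$; - a "luxury" horizontal step $(1,0)$ of cost $2$. The two kinds of horizontal steps are distinguished. The cost of a path is the sum of the costs of its steps. $r_k$ is the number of such paths (finite sequences of steps) of total cost $k$ whose starting point and endpoint lie at the same height. There is no restriction that the path stay above its starting level. The empty path is counted, so $r_0=1$. *)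

theory Defs
  imports "HOL-Analysis.Analysis"
begin

(* The convex hull of a two-element set {x, y} is the straight segment closed_segment x y. *)
definition noncrossing_pairings :: "(real ^ 2) set \<Rightarrow> (real ^ 2) set set set" where
  "noncrossing_pairings P =
     {M. partition_on P M \<and> (\<forall>e\<in>M. card e = 2) \<and>
         (\<forall>e\<in>M. \<forall>f\<in>M. e \<noteq> f \<longrightarrow> convex hull e \<inter> convex hull f = {})}"

datatype step = Up | Down | Cheap | Luxury

fun step_vector :: "step \<Rightarrow> int \<times> int" where
  "step_vector Up = (1, 1)"
| "step_vector Down = (1, -1)"
| "step_vector Cheap = (1, 0)"
| "step_vector Luxury = (1, 0)"

fun step_cost :: "step \<Rightarrow> real" where
  "step_cost Up = 3/2"
| "step_cost Down = 3/2"
| "step_cost Cheap = 1"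
| "step_cost Luxury = 2"

(* Paths are taken up to translation, that is, as sequences of steps. All costs are at least 1,
   so the sets of paths counted here are finite. *)
definition num_level_paths :: "nat \<Rightarrow> nat" where
  "num_level_paths k =
     card {w :: step list. (\<Sum>s\<leftarrow>w. step_cost s) = real k \<and> snd (\<Sum>s\<leftarrow>w. step_vector s) = 0}"

end

theory Submission
  imports Defs
begin

text \<open>
  Every point is an endpoint, so a segment between two points of the same line joins neighbouring
  points, and the points left over on the two lines must then be joined across in their linear order.
  So a noncrossing pairing is the same as a tiling of each row by monomers and dimers, with equally
  many monomers in both rows; there are \<open>(k - d choose d)\<^sup>2\<close> of these with \<open>d\<close> dimers in each row
  when both rows have \<open>k\<close> points.

  Reading the \<open>i\<close>-th tiles of the two rows as one step (both monomers: cheap, both dimers: luxury,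
  dimer only in the first row: up, dimer only in the second row: down) turns a pair of tilings with
  equally many tiles into a path. The cost of a step is the mean length of its two tiles, and
  the height of the path counts the surplus of dimers in the first row.
\<close>

section \<open>Counting level paths\<close>

text \<open>The two filters pick the steps whose first-row tile, respectively second-row tile, is a
  dimer. Each dimer adds one half to the base cost 1 of its step and moves the path up or down
  according to its row.\<close>

lemma list_cost_height:
  "(\<Sum>s\<leftarrow>w. step_cost s) = real (length w) + (real (length (filter (\<lambda>s. s \<in> {Up, Luxury}) w))
     + real (length (filter (\<lambda>s. s \<in> {Down, Luxury}) w))) / 2"
  "snd (\<Sum>s\<leftarrow>w. step_vector s) = int (length (filter (\<lambda>s. s \<in> {Up, Luxury}) w))
     - int (length (filter (\<lambda>s. s \<in> {Down, Luxury}) w))"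
proof (induction w)
  case (Cons s w)
  { case 1 then show ?case using Cons by (cases s) (auto simp: field_simps) }
  { case 2 then show ?case using Cons by (cases s) auto }
qed auto

text \<open>A step amounts to two independent bits, one per row, telling whether the tile is a
  dimer. A word is therefore two independently chosen sets of positions.\<close>

lemma card_step_lists:
  "card {w. length w = n \<and> length (filter (\<lambda>s. s \<in> {Up, Luxury}) w) = i
     \<and> length (filter (\<lambda>s. s \<in> {Down, Luxury}) w) = j} = (n choose i) * (n choose j)"
proof -
  let ?W = "{w. length w = n \<and> length (filter (\<lambda>s. s \<in> {Up, Luxury}) w) = i
     \<and> length (filter (\<lambda>s. s \<in> {Down, Luxury}) w) = j}"
  let ?C = "\<lambda>i. {P. P \<subseteq> {..<n} \<and> card P = i}"
  let ?pos = "\<lambda>w S. {l. l < length w \<and> w ! l \<in> S}"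
  \<comment> \<open>A step is rebuilt from its bits: \<open>t\<close> for a dimer in the first row,
    \<open>b\<close> for one in the second.\<close>
  let ?step = "\<lambda>t b. if t then if b then Luxury else Up else if b then Down else Cheap"
  let ?word = "\<lambda>(P, Q). map (\<lambda>l. ?step (l \<in> P) (l \<in> Q)) [0..<n]"
  have step: "?step (s \<in> {Up, Luxury}) (s \<in> {Down, Luxury}) = s" for s
    by (cases s) auto
  have "bij_betw (\<lambda>w. (?pos w {Up, Luxury}, ?pos w {Down, Luxury})) ?W (?C i \<times> ?C j)"
  proof (rule bij_betw_byWitness[where f' = ?word])
    show "\<forall>w\<in>?W. ?word (?pos w {Up, Luxury}, ?pos w {Down, Luxury}) = w"
    proof
      fix w assume w: "w \<in> ?W"
      show "?word (?pos w {Up, Luxury}, ?pos w {Down, Luxury}) = w"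
      proof (rule nth_equalityI)
        show "length (?word (?pos w {Up, Luxury}, ?pos w {Down, Luxury})) = length w"
          using w by simp
        fix l assume "l < length (?word (?pos w {Up, Luxury}, ?pos w {Down, Luxury}))"
        then have l: "l < n" "l < length w" using w by auto
        show "?word (?pos w {Up, Luxury}, ?pos w {Down, Luxury}) ! l = w ! l"
          using l by (cases "w ! l") simp_all
      qed
    qed
    have pos: "?pos (?word (P, Q)) {Up, Luxury} = P" "?pos (?word (P, Q)) {Down, Luxury} = Q"
      if "P \<subseteq> {..<n}" "Q \<subseteq> {..<n}" for P Q
      using that by (auto split: if_splits)
    show "\<forall>pq\<in>?C i \<times> ?C j. (?pos (?word pq) {Up, Luxury}, ?pos (?word pq) {Down, Luxury}) = pq"
    proof
      fix pq assume "pq \<in> ?C i \<times> ?C j"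
      then obtain P Q where "pq = (P, Q)" "P \<subseteq> {..<n}" "Q \<subseteq> {..<n}" by blast
      then show "(?pos (?word pq) {Up, Luxury}, ?pos (?word pq) {Down, Luxury}) = pq"
        by (simp only: pos)
    qed
    show "(\<lambda>w. (?pos w {Up, Luxury}, ?pos w {Down, Luxury})) ` ?W \<subseteq> ?C i \<times> ?C j"
      unfolding length_filter_conv_card by auto
    show "?word ` (?C i \<times> ?C j) \<subseteq> ?W"
    proof
      fix w assume "w \<in> ?word ` (?C i \<times> ?C j)"
      then obtain P Q where w: "w = ?word (P, Q)" and
        PQ: "P \<subseteq> {..<n}" "Q \<subseteq> {..<n}" "card P = i" "card Q = j" by blast
      have "length w = n" using w by simp
      moreover have "?pos w {Up, Luxury} = P" "?pos w {Down, Luxury} = Q"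
        using pos[OF PQ(1,2)] unfolding w by blast+
      ultimately show "w \<in> ?W"
        using PQ(3,4) unfolding length_filter_conv_card by blast
    qed
  qed
  from bij_betw_same_card[OF this] show ?thesis
    by (simp add: card_cartesian_product n_subsets)
qed

text \<open>Height zero means that both rows have the same number \<open>d\<close> of dimers. The
  cost is then the length plus \<open>d\<close>, so cost \<open>k\<close> forces length
  \<open>k - d\<close>.\<close>

lemma num_level_paths_eq: "num_level_paths k = (\<Sum>d\<le>k. ((k - d) choose d)\<^sup>2)"
proof -
  let ?W = "\<lambda>d. {w. length w = k - d \<and> length (filter (\<lambda>s. s \<in> {Up, Luxury}) w) = d
     \<and> length (filter (\<lambda>s. s \<in> {Down, Luxury}) w) = d}"
  have fin: "finite (?W d)" for d
  proof (rule finite_subset)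
    show "?W d \<subseteq> {w. set w \<subseteq> {Up, Down, Cheap, Luxury} \<and> length w = k - d}"
      using step.exhaust by auto
  qed (rule finite_lists_length_eq, simp)
  have eq: "{w. (\<Sum>s\<leftarrow>w. step_cost s) = real k \<and> snd (\<Sum>s\<leftarrow>w. step_vector s) = 0} = (\<Union>d\<le>k. ?W d)"
  proof (intro set_eqI iffI)
    fix w assume "w \<in> {w. (\<Sum>s\<leftarrow>w. step_cost s) = real k \<and> snd (\<Sum>s\<leftarrow>w. step_vector s) = 0}"
    then have "real (length w) + real (length (filter (\<lambda>s. s \<in> {Down, Luxury}) w)) = real k"
      "length (filter (\<lambda>s. s \<in> {Up, Luxury}) w) = length (filter (\<lambda>s. s \<in> {Down, Luxury}) w)"
      unfolding list_cost_height by auto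
    \<comment> \<open>The index is the common number of dimers. It is at most \<open>k\<close>, so
      \<open>k - d\<close> is not truncated.\<close>
    then show "w \<in> (\<Union>d\<le>k. ?W d)"
      unfolding of_nat_add[symmetric] of_nat_eq_iff by auto
  next
    fix w assume "w \<in> (\<Union>d\<le>k. ?W d)"
    then show "w \<in> {w. (\<Sum>s\<leftarrow>w. step_cost s) = real k \<and> snd (\<Sum>s\<leftarrow>w. step_vector s) = 0}"
      unfolding list_cost_height by auto
  qed
  have "num_level_paths k = (\<Sum>d\<le>k. card (?W d))"
    unfolding num_level_paths_def eq by (rule card_UN_disjoint) (use fin in auto)
  then show ?thesis by (simp only: card_step_lists power2_eq_square)
qed

section \<open>Ranks in a finite set\<close>

text \<open>Rank, counted from 0, strictly increases along \<open>h\<close>, hence is injective on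
  \<open>P\<close>. Its values lie below \<open>card P\<close>, so by cardinality they fill the
  whole initial segment.\<close>

lemma bij_betw_rank:
  fixes h :: "'a \<Rightarrow> 'b::linorder"
  assumes "finite P" "inj_on h P"
  shows "bij_betw (\<lambda>p. card {x\<in>P. h x < h p}) P {..<card P}"
proof -
  let ?r = "\<lambda>p. card {x\<in>P. h x < h p}"
  have mono: "?r p < ?r q" if "p \<in> P" "h p < h q" for p q
    by (rule psubset_card_mono) (use assms that in auto)
  have "inj_on ?r P"
  proof (rule inj_onI)
    fix p q assume pq: "p \<in> P" "q \<in> P" "?r p = ?r q"
    then have "h p = h q" using mono[of p q] mono[of q p]
      by (cases "h p" "h q" rule: linorder_cases) simp_all
    then show "p = q" using pq assms(2) by (simp add: inj_on_eq_iff)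
  qed
  moreover have "?r ` P \<subseteq> {..<card P}"
  proof
    fix i assume "i \<in> ?r ` P"
    then obtain p where p: "p \<in> P" "i = ?r p" by blast
    have "?r p < card P" by (rule psubset_card_mono) (use assms(1) p in auto)
    then show "i \<in> {..<card P}" using p by simp
  qed
  ultimately show ?thesis
    by (simp add: bij_betw_def card_subset_eq card_image)
qed

section \<open>Tilings of a single row\<close>

text \<open>Partial pairings of a row: the members are the dimers, the points outside their union
  the monomers.\<close>

definition adjacent_pairings :: "(real ^ 2) set \<Rightarrow> (real ^ 2) set set set" where
  "adjacent_pairings P = {X. disjoint X \<and> (\<forall>e\<in>X. card e = 2 \<and> convex hull e \<inter> P = e)}"

lemma adjacent_pairings_subset: "X \<in> adjacent_pairings P \<Longrightarrow> e \<in> X \<Longrightarrow> e \<subseteq> P"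
  unfolding adjacent_pairings_def by blast

lemma finite_adjacent_pairings:
  assumes "finite P"
  shows "finite (adjacent_pairings P)" "X \<in> adjacent_pairings P \<Longrightarrow> finite X"
proof -
  have sub: "adjacent_pairings P \<subseteq> Pow (Pow P)"
    using adjacent_pairings_subset by blast
  then show "finite (adjacent_pairings P)"
    by (rule finite_subset) (simp add: assms)
  show "finite X" if "X \<in> adjacent_pairings P"
    by (rule finite_subset[of _ "Pow P"]) (use that sub assms in auto)
qed

lemma card_Union_adjacent_pairing:
  assumes "finite P" "X \<in> adjacent_pairings P"
  shows "card (\<Union>X) = 2 * card X"
proof -
  have "card (\<Union>X) = sum card X"
  proof (rule card_Union_disjoint)
    show "disjoint X" using assms(2) unfolding adjacent_pairings_def by blast
    show "finite e" if "e \<in> X" for e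
      using adjacent_pairings_subset[OF assms(2) that] assms(1) finite_subset by blast
  qed
  also have "\<dots> = 2 * card X"
    using assms(2) unfolding adjacent_pairings_def by simp
  finally show ?thesis .
qed

text \<open>Deleting points that no pair uses puts nothing new on the segments.\<close>

lemma adjacent_pairings_restrict:
  assumes "X \<in> adjacent_pairings P" "Q \<subseteq> P" "\<Union>X \<subseteq> Q"
  shows "X \<in> adjacent_pairings Q"
  using assms unfolding adjacent_pairings_def by blast

lemma adjacent_pairings_mono: "X \<in> adjacent_pairings P \<Longrightarrow> X' \<subseteq> X \<Longrightarrow> X' \<in> adjacent_pairings P"
  unfolding adjacent_pairings_def using pairwise_subset[of disjnt X X'] by auto

lemma adjacent_pairings_insert:
  assumes "X \<in> adjacent_pairings P" "card e = 2" "convex hull e \<inter> P = e" "\<Union>X \<inter> e = {}"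
  shows "insert e X \<in> adjacent_pairings P"
proof -
  have "disjoint (insert e X)"
    using assms(1,4) unfolding adjacent_pairings_def pairwise_insert disjnt_def by blast
  then show ?thesis using assms(1-3) unfolding adjacent_pairings_def by simp
qed

text \<open>The added points lie beyond all of \<open>Q\<close> in direction \<open>m\<close>, so
  none of them falls on a segment between points of \<open>Q\<close>.\<close>

lemma adjacent_pairings_extend:
  assumes X: "X \<in> adjacent_pairings Q" and "Q \<subseteq> P"
    and less: "\<And>p q. p \<in> P - Q \<Longrightarrow> q \<in> Q \<Longrightarrow> m \<bullet> q < m \<bullet> p"
  shows "X \<in> adjacent_pairings P"
proof -
  have "convex hull e \<inter> P = e" if e: "e \<in> X" for e
  proof -
    have "p \<notin> convex hull e" if p: "p \<in> P - Q" for p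
    proof -
      \<comment> \<open>An open half-plane is convex, so it contains the segment as soon as it
        contains both endpoints.\<close>
      have "convex hull e \<subseteq> {x. m \<bullet> x < m \<bullet> p}"
        using less[OF p] adjacent_pairings_subset[OF X e]
        by (intro hull_minimal convex_halfspace_lt) blast
      then show ?thesis by blast
    qed
    then show ?thesis using X e assms(2) unfolding adjacent_pairings_def by blast
  qed
  then show ?thesis using X unfolding adjacent_pairings_def by blast
qed

section \<open>Coordinates along and across the rows\<close>

text \<open>Each row is a level set of \<open>n\<close>, and \<open>m\<close> orders the points on
  it. The assumption says that the two functionals together are coordinates of the plane.\<close>

locale plane_coordinates =
  fixes m n :: "real ^ 2"
  assumes coords_eqI: "m \<bullet> x = m \<bullet> y \<Longrightarrow> n \<bullet> x = n \<bullet> y \<Longrightarrow> x = y"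
begin

text \<open>On a level line of \<open>n\<close> the coordinate \<open>m\<close> is affine and
  injective, so segments there correspond to real intervals with the same parameter.\<close>

lemma row_segment_iff:
  assumes "n \<bullet> x = \<alpha>" "n \<bullet> y = \<alpha>"
  shows "p \<in> closed_segment x y \<longleftrightarrow> n \<bullet> p = \<alpha> \<and> m \<bullet> p \<in> closed_segment (m \<bullet> x) (m \<bullet> y)"
proof
  assume "p \<in> closed_segment x y"
  then obtain u where u: "0 \<le> u" "u \<le> 1" "p = (1 - u) *\<^sub>R x + u *\<^sub>R y"
    by (auto simp: in_segment)
  have "n \<bullet> p = \<alpha>" "m \<bullet> p = (1 - u) * (m \<bullet> x) + u * (m \<bullet> y)"
    unfolding u(3) by (simp_all add: inner_add_right assms algebra_simps)
  then show "n \<bullet> p = \<alpha> \<and> m \<bullet> p \<in> closed_segment (m \<bullet> x) (m \<bullet> y)"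
    using u(1,2) by (auto simp: in_segment)
next
  assume p: "n \<bullet> p = \<alpha> \<and> m \<bullet> p \<in> closed_segment (m \<bullet> x) (m \<bullet> y)"
  then obtain u where u: "0 \<le> u" "u \<le> 1" "m \<bullet> p = (1 - u) * (m \<bullet> x) + u * (m \<bullet> y)"
    by (auto simp: in_segment)
  have "p = (1 - u) *\<^sub>R x + u *\<^sub>R y"
    by (rule coords_eqI) (use u p assms in \<open>auto simp: inner_add_right algebra_simps\<close>)
  then show "p \<in> closed_segment x y" using u by (auto simp: in_segment)
qed

text \<open>Orients a pair from left to right, so that its segment becomes an interval in the
  coordinate \<open>m\<close>.\<close>

lemma row_pairE:
  assumes "card e = 2" "e \<subseteq> {x. n \<bullet> x = \<alpha>}"
  obtains x y where "e = {x, y}" "m \<bullet> x < m \<bullet> y"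
    "convex hull e = {p. n \<bullet> p = \<alpha> \<and> m \<bullet> x \<le> m \<bullet> p \<and> m \<bullet> p \<le> m \<bullet> y}"
proof -
  obtain a b where ab: "e = {a, b}" "a \<noteq> b"
    using assms(1) by (meson card_2_iff)
  then have "m \<bullet> a \<noteq> m \<bullet> b" using coords_eqI assms(2) by auto
  then obtain x y where xy: "e = {x, y}" "m \<bullet> x < m \<bullet> y"
    using ab by (metis insert_commute linorder_neqE_linordered_idom)
  have "convex hull e = {p. n \<bullet> p = \<alpha> \<and> m \<bullet> x \<le> m \<bullet> p \<and> m \<bullet> p \<le> m \<bullet> y}"
    unfolding xy(1) segment_convex_hull[symmetric]
    using row_segment_iff[of x \<alpha> y] xy assms(2)
    by (auto simp: closed_segment_eq_real_ivl)
  then show ?thesis using that xy by blast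
qed

lemma inj_on_row: "P \<subseteq> {x. n \<bullet> x = \<alpha>} \<Longrightarrow> inj_on ((\<bullet>) m) P"
  by (rule inj_onI) (auto intro: coords_eqI)

text \<open>If two intervals meet, the larger of their left ends lies in both. Being a point of
  \<open>P\<close>, it would belong to both pairs.\<close>

lemma hulls_disjoint:
  assumes P: "P \<subseteq> {x. n \<bullet> x = \<alpha>}"
    and e: "card e = 2" "convex hull e \<inter> P = e" and f: "card f = 2" "convex hull f \<inter> P = f"
    and disj: "e \<inter> f = {}"
  shows "convex hull e \<inter> convex hull f = {}"
proof (rule ccontr)
  assume "convex hull e \<inter> convex hull f \<noteq> {}"
  then obtain p where p: "p \<in> convex hull e" "p \<in> convex hull f" by blast
  have sub: "e \<subseteq> {x. n \<bullet> x = \<alpha>}" "f \<subseteq> {x. n \<bullet> x = \<alpha>}" using P e f by blast+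
  obtain x y where x: "e = {x, y}" "m \<bullet> x < m \<bullet> y"
    "convex hull e = {p. n \<bullet> p = \<alpha> \<and> m \<bullet> x \<le> m \<bullet> p \<and> m \<bullet> p \<le> m \<bullet> y}"
    using row_pairE[OF e(1) sub(1)] .
  obtain x' y' where x': "f = {x', y'}" "m \<bullet> x' < m \<bullet> y'"
    "convex hull f = {p. n \<bullet> p = \<alpha> \<and> m \<bullet> x' \<le> m \<bullet> p \<and> m \<bullet> p \<le> m \<bullet> y'}"
    using row_pairE[OF f(1) sub(2)] .
  have "x \<in> convex hull f \<or> x' \<in> convex hull e"
  proof (cases "m \<bullet> x \<le> m \<bullet> x'")
    case True
    then have "x' \<in> convex hull e"
      using p sub x'(1) unfolding x(3) x'(3) by auto
    then show ?thesis ..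
  next
    case False
    then have "x \<in> convex hull f"
      using p sub x(1) unfolding x(3) x'(3) by auto
    then show ?thesis ..
  qed
  moreover have "x \<in> P" "x' \<in> P" "x \<in> e" "x' \<in> f" using e f x(1) x'(1) by blast+
  ultimately show False using e(2) f(2) disj by blast
qed

section \<open>Counting the tilings of a row\<close>

text \<open>The last point \<open>z\<close> is either a monomer or forms a dimer with its
  predecessor \<open>y\<close>. Removing that tile gives a recursion in the numbers of points and
  dimers which is Pascal's rule for these binomials.\<close>

lemma card_adjacent_pairings:
  assumes "finite P" "P \<subseteq> {x. n \<bullet> x = \<alpha>}"
  shows "card {X \<in> adjacent_pairings P. card X = d} = (card P - d) choose d"
  using assms
proof (induction "card P" arbitrary: P d rule: less_induct)
  case less
  note fin = \<open>finite P\<close> and row = \<open>P \<subseteq> {x. n \<bullet> x = \<alpha>}\<close>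
  note finX = finite_adjacent_pairings(2)[OF fin]
  show ?case
  proof (cases d)
    case 0
    have "{X \<in> adjacent_pairings P. card X = d} = {{}}"
      using finX 0 by (auto simp: adjacent_pairings_def)
    then show ?thesis using 0 by simp
  next
    case (Suc d')
    show ?thesis
    proof (cases "card P \<ge> 2")
      case False
      have "X = {}" if "X \<in> adjacent_pairings P" for X
      proof (rule ccontr)
        assume "X \<noteq> {}"
        then obtain e where "e \<in> X" by blast
        then have "card e = 2" "e \<subseteq> P"
          using that unfolding adjacent_pairings_def by blast+
        then show False using card_mono[OF fin, of e] False by simp
      qed
      then have empty: "{X \<in> adjacent_pairings P. card X = d} = {}" using Suc by fastforce
      show ?thesis unfolding empty using False Suc by simp
    next
      case True
      have max: "\<exists>z\<in>Q. \<forall>q\<in>Q-{z}. m \<bullet> q < m \<bullet> z" if "Q \<noteq> {}" "Q \<subseteq> P" for Q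
      proof -
        have Q: "finite Q" using that fin finite_subset by blast
        define c where "c = Max ((\<bullet>) m ` Q)"
        have "c \<in> (\<bullet>) m ` Q" unfolding c_def using Q that by (intro Max_in) auto
        then obtain z where z: "z \<in> Q" "m \<bullet> z = c" by auto
        have "m \<bullet> q < m \<bullet> z" if "q \<in> Q - {z}" for q
        proof -
          have "m \<bullet> q \<le> m \<bullet> z" using Q that unfolding z(2) c_def by (intro Max_ge) auto
          moreover have "m \<bullet> q \<noteq> m \<bullet> z"
            using inj_on_row[OF row] that z(1) \<open>Q \<subseteq> P\<close> unfolding inj_on_def by blast
          ultimately show ?thesis by simp
        qed
        then show ?thesis using z(1) by blast
      qed
      obtain z where z: "z \<in> P" "\<And>q. q \<in> P - {z} \<Longrightarrow> m \<bullet> q < m \<bullet> z"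
        using max[of P] True by fastforce
      have cardz: "card (P - {z}) = card P - 1" using z fin by simp
      have "P - {z} \<noteq> {}" using cardz True by force
      then obtain y where y: "y \<in> P - {z}" "\<And>q. q \<in> P - {z} - {y} \<Longrightarrow> m \<bullet> q < m \<bullet> y"
        using max[of "P - {z}"] by blast
      have pair2: "card {z, y} = 2" using y by auto
      then have cardyz: "card (P - {z, y}) = card P - 2"
        using z y fin by (subst card_Diff_subset) auto
      have zy: "m \<bullet> y < m \<bullet> z" using y z by blast
      let ?S = "\<lambda>Q d. {X \<in> adjacent_pairings Q. card X = d}"
      \<comment> \<open>A point of \<open>P\<close> on this segment has \<open>m\<close>-coordinate
        at least that of \<open>y\<close>, and only \<open>y\<close> and \<open>z\<close>
        do.\<close>
      have hull_zy: "convex hull {z, y} \<inter> P = {z, y}"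
      proof -
        have "{z, y} \<subseteq> {x. n \<bullet> x = \<alpha>}" using z y row by auto
        from row_pairE[OF pair2 this] obtain a b where ab: "{z, y} = {a, b}" "m \<bullet> a < m \<bullet> b"
          "convex hull {z, y} = {p. n \<bullet> p = \<alpha> \<and> m \<bullet> a \<le> m \<bullet> p \<and> m \<bullet> p \<le> m \<bullet> b}" .
        have "a = y" "b = z" using ab zy by (auto simp: doubleton_eq_iff)
        then have "p \<in> {z, y}" if "p \<in> convex hull {z, y}" "p \<in> P" for p
          using ab(3) that y(2)[of p] by fastforce
        moreover have "{z, y} \<subseteq> convex hull {z, y}" by (rule hull_subset)
        ultimately show ?thesis using z y by blast
      qed
      \<comment> \<open>The two families are the tilings leaving \<open>z\<close> uncovered and
        those in which a dimer covers it.\<close>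
      have eq: "?S P d = ?S (P - {z}) d \<union> insert {z, y} ` ?S (P - {z, y}) d'"
      proof (intro equalityI subsetI)
        fix X assume X: "X \<in> ?S P d"
        show "X \<in> ?S (P - {z}) d \<union> insert {z, y} ` ?S (P - {z, y}) d'"
        proof (cases "z \<in> \<Union>X")
          case False
          then have "\<Union>X \<subseteq> P - {z}" using X adjacent_pairings_subset by blast
          then have "X \<in> adjacent_pairings (P - {z})"
            using X adjacent_pairings_restrict[of X P "P - {z}"] by blast
          then show ?thesis using X by blast
        next
          case True
          then obtain e where e: "e \<in> X" "z \<in> e" by blast
          have e2: "card e = 2" "convex hull e \<inter> P = e"
            using X e unfolding adjacent_pairings_def by blast+
          have "e \<subseteq> {x. n \<bullet> x = \<alpha>}" using e2 row by blast
          from row_pairE[OF e2(1) this] obtain a b where ab: "e = {a, b}" "m \<bullet> a < m \<bullet> b"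
            "convex hull e = {p. n \<bullet> p = \<alpha> \<and> m \<bullet> a \<le> m \<bullet> p \<and> m \<bullet> p \<le> m \<bullet> b}" .
          have abP: "a \<in> P" "b \<in> P" using e2 ab by blast+
          have "b = z" using ab e z(2)[of b] abP by fastforce
          \<comment> \<open>With a partner further left, \<open>y\<close> would lie on the segment
            without being one of its ends.\<close>
          have "a = y"
          proof (rule ccontr)
            assume ne: "a \<noteq> y"
            have "a \<noteq> z" using ab(2) \<open>b = z\<close> by blast
            then have "m \<bullet> a < m \<bullet> y" using ne abP y(2) by blast
            then have "y \<in> convex hull e"
              unfolding ab(3) using y row zy \<open>b = z\<close> by auto
            then have "y \<in> e" using e2 y by blast
            then show False using ab ne \<open>b = z\<close> y by blast
          qed
          then have ezy: "e = {z, y}" using ab \<open>b = z\<close> by blast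
          have "disjoint X" using X unfolding adjacent_pairings_def by blast
          then have "\<Union>(X - {e}) \<inter> e = {}"
            using e unfolding disjoint_def by blast
          then have "\<Union>(X - {e}) \<subseteq> P - {z, y}"
            using X adjacent_pairings_subset ezy by blast
          moreover have "X - {e} \<in> adjacent_pairings P"
            using X adjacent_pairings_mono[of X P "X - {e}"] by blast
          ultimately have "X - {e} \<in> adjacent_pairings (P - {z, y})"
            using adjacent_pairings_restrict[of "X - {e}" P "P - {z, y}"] by blast
          moreover have "card (X - {e}) = d'"
            using X Suc e finX by (simp add: card_Diff_singleton)
          ultimately have "X - {e} \<in> ?S (P - {z, y}) d'" by blast
          moreover have "X = insert {z, y} (X - {e})" using e ezy by blast
          ultimately show ?thesis by blast
        qed
      next
        fix X assume "X \<in> ?S (P - {z}) d \<union> insert {z, y} ` ?S (P - {z, y}) d'"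
        then show "X \<in> ?S P d"
        proof
          assume "X \<in> ?S (P - {z}) d"
          then show ?thesis using adjacent_pairings_extend[of X "P - {z}" P m] z by blast
        next
          assume "X \<in> insert {z, y} ` ?S (P - {z, y}) d'"
          then obtain X' where X': "X = insert {z, y} X'" "X' \<in> adjacent_pairings (P - {z, y})"
            "card X' = d'" by blast
          have sub: "\<Union>X' \<subseteq> P - {z, y}" using X' adjacent_pairings_subset by blast
          have "X' \<in> adjacent_pairings P"
          proof (rule adjacent_pairings_extend[OF X'(2)])
            fix p q assume "p \<in> P - (P - {z, y})" "q \<in> P - {z, y}"
            then show "m \<bullet> q < m \<bullet> p" using z(2)[of q] y(2)[of q] by blast
          qed blast
          then have "X \<in> adjacent_pairings P"
            unfolding X'(1) by (rule adjacent_pairings_insert[OF _ pair2 hull_zy]) (use sub in blast)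
          moreover have "{z, y} \<notin> X'" using sub by blast
          ultimately show ?thesis
            using X' Suc finite_adjacent_pairings(2)[of "P - {z, y}" X'] fin by auto
        qed
      qed
      have "card (?S P d) = card (?S (P - {z}) d) + card (insert {z, y} ` ?S (P - {z, y}) d')"
        unfolding eq
      proof (rule card_Un_disjoint)
        show "finite (?S (P - {z}) d)" "finite (insert {z, y} ` ?S (P - {z, y}) d')"
          using finite_adjacent_pairings(1) fin by auto
        show "?S (P - {z}) d \<inter> insert {z, y} ` ?S (P - {z, y}) d' = {}"
          using adjacent_pairings_subset by blast
      qed
      also have "card (insert {z, y} ` ?S (P - {z, y}) d') = card (?S (P - {z, y}) d')"
      proof (rule card_image, rule inj_onI)
        fix X X' assume X: "X \<in> ?S (P - {z, y}) d'" "X' \<in> ?S (P - {z, y}) d'"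
          "insert {z, y} X = insert {z, y} X'"
        then have "{z, y} \<notin> X" "{z, y} \<notin> X'" using adjacent_pairings_subset by blast+
        then show "X = X'" using X(3) insert_ident[of "{z, y}" X X'] by simp
      qed
      also have "card (?S (P - {z}) d) = (card P - 1 - d) choose d"
        using less.hyps[of "P - {z}" d] cardz True fin row by auto
      also have "card (?S (P - {z, y}) d') = (card P - 2 - d') choose d'"
        using less.hyps[of "P - {z, y}" d'] cardyz True fin row by auto
      \<comment> \<open>For \<open>d' \<le> card P - 2\<close> this is Pascal's rule. Otherwise the
        truncated differences are all 0 while \<open>d\<close> and \<open>d'\<close> are positive,
        so all three binomials vanish.\<close>
      also have "((card P - 1 - d) choose d) + ((card P - 2 - d') choose d') = (card P - d) choose d"
      proof (cases "d' \<le> card P - 2")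
        case True
        then have "card P - d = Suc (card P - 2 - d')" "card P - 1 - d = card P - 2 - d'"
          using \<open>card P \<ge> 2\<close> Suc by linarith+
        then show ?thesis using Suc by simp
      next
        case False
        then have "card P - d = 0" "card P - 1 - d = 0" "card P - 2 - d' = 0" "d' > 0"
          using Suc by linarith+
        then show ?thesis using Suc by simp
      qed
      finally show ?thesis .
    qed
  qed
qed

end

text \<open>If \<open>h p < h q\<close>, the counted set grows and gains at least \<open>p\<close>
  itself; otherwise the set for \<open>q\<close> is contained in the one for
  \<open>p\<close>.\<close>

lemma card_less_iff:
  fixes h :: "'a \<Rightarrow> 'b::linorder"
  assumes "finite P" "p \<in> P"
  shows "card {x\<in>P. h x < h p} < card {x\<in>P. h x < h q} \<longleftrightarrow> h p < h q"
proof
  assume "h p < h q"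
  then show "card {x\<in>P. h x < h p} < card {x\<in>P. h x < h q}"
    using assms by (intro psubset_card_mono) auto
next
  assume lt: "card {x\<in>P. h x < h p} < card {x\<in>P. h x < h q}"
  show "h p < h q"
  proof (rule ccontr)
    assume "\<not> h p < h q"
    then have "card {x\<in>P. h x < h q} \<le> card {x\<in>P. h x < h p}"
      using assms by (intro card_mono) auto
    then show False using lt by simp
  qed
qed

section \<open>Pairs joining the two rows\<close>

lemma noncrossing_pairingsD:
  assumes "M \<in> noncrossing_pairings P"
  shows "\<Union>M = P" "e \<in> M \<Longrightarrow> card e = 2"
    "e \<in> M \<Longrightarrow> f \<in> M \<Longrightarrow> e \<noteq> f \<Longrightarrow> convex hull e \<inter> convex hull f = {}"
    "e \<in> M \<Longrightarrow> f \<in> M \<Longrightarrow> x \<in> e \<Longrightarrow> x \<in> f \<Longrightarrow> e = f"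
  using assms unfolding noncrossing_pairings_def partition_on_def disjoint_def by auto

text \<open>A partner in \<open>A\<close> would put the pair of \<open>p\<close> inside
  \<open>A\<close>, so the partner is in \<open>B\<close>. Its only block contains \<open>p\<close>
  and thus is not inside \<open>B\<close>, which makes it a monomer too.\<close>

lemma noncrossing_pairing_partner:
  assumes M: "M \<in> noncrossing_pairings (A \<union> B)" and p: "p \<in> A - \<Union>{e \<in> M. e \<subseteq> A}"
    and "A \<inter> B = {}"
  shows "\<exists>q \<in> B - \<Union>{e \<in> M. e \<subseteq> B}. {p, q} \<in> M"
proof -
  note part = noncrossing_pairingsD(1,4)[OF M] and card2 = noncrossing_pairingsD(2)[OF M]
  obtain e where e: "e \<in> M" "p \<in> e" using p part by blast
  obtain a b where "e = {a, b}" using card2[OF e(1)] by (meson card_2_iff)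
  then obtain q where q: "e = {p, q}" using e(2) by blast
  have "q \<in> A \<union> B" using q e(1) part by blast
  moreover have "q \<notin> A" using p e q by blast
  ultimately have "q \<in> B" by blast
  moreover have "q \<notin> f" if f: "f \<in> M" "f \<subseteq> B" for f
  proof -
    have "p \<notin> f" using f p assms(3) by blast
    then have "f \<noteq> e" using e by blast
    then show ?thesis using part(2)[OF f(1) e(1)] q by blast
  qed
  ultimately show ?thesis using e q by blast
qed

text \<open>Such a block has a point in \<open>A\<close>. This point is in no other block, so it is
  a monomer, and its partner is supplied by the previous lemma.\<close>

lemma noncrossing_pairing_mixed:
  assumes M: "M \<in> noncrossing_pairings (A \<union> B)" and AB: "A \<inter> B = {}"
    and e: "e \<in> M" "\<not> e \<subseteq> A" "\<not> e \<subseteq> B"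
  shows "\<exists>p \<in> A - \<Union>{e \<in> M. e \<subseteq> A}. \<exists>q \<in> B - \<Union>{e \<in> M. e \<subseteq> B}. e = {p, q}"
proof -
  note part = noncrossing_pairingsD(1,4)[OF M]
  obtain p where p: "p \<in> e" "p \<in> A" using e part(1) by blast
  have "p \<notin> f" if "f \<in> M" "f \<subseteq> A" for f using part(2)[OF that(1) e(1)] that(2) e p by blast
  then have pP: "p \<in> A - \<Union>{e \<in> M. e \<subseteq> A}" using p by blast
  from noncrossing_pairing_partner[OF M this AB]
  obtain q where q: "q \<in> B - \<Union>{e \<in> M. e \<subseteq> B}" "{p, q} \<in> M" by blast
  then have "e = {p, q}" using part(2)[OF e(1) q(2) p(1)] by blast
  then show ?thesis using pP q by blast
qed

section \<open>Segments from one line to the other\<close>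

context plane_coordinates
begin

text \<open>The coordinate \<open>n\<close> forces a common point to have the same parameter
  \<open>u\<close> on both segments. But at equal parameters the \<open>m\<close>-coordinates stay
  strictly ordered, being weighted means of strictly ordered ends.\<close>

lemma crossing_segments_disjoint:
  assumes row: "n \<bullet> p = \<alpha>" "n \<bullet> p' = \<alpha>" "n \<bullet> q = \<beta>" "n \<bullet> q' = \<beta>" "\<alpha> \<noteq> \<beta>"
    and lt: "m \<bullet> p < m \<bullet> p'" "m \<bullet> q < m \<bullet> q'"
  shows "closed_segment p q \<inter> closed_segment p' q' = {}"
proof (rule ccontr)
  assume "closed_segment p q \<inter> closed_segment p' q' \<noteq> {}"
  then obtain x where "x \<in> closed_segment p q" "x \<in> closed_segment p' q'" by blast
  then obtain u u' where u: "0 \<le> u" "u \<le> 1" "x = (1 - u) *\<^sub>R p + u *\<^sub>R q"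
    and u': "x = (1 - u') *\<^sub>R p' + u' *\<^sub>R q'"
    by (auto simp: in_segment)
  have "n \<bullet> x = \<alpha> + u * (\<beta> - \<alpha>)"
    unfolding u(3) by (simp add: inner_add_right row algebra_simps)
  moreover have "n \<bullet> x = \<alpha> + u' * (\<beta> - \<alpha>)"
    unfolding u' by (simp add: inner_add_right row algebra_simps)
  ultimately have uu: "u' = u" using row(5) by simp
  have "m \<bullet> x = (1 - u) * (m \<bullet> p) + u * (m \<bullet> q)"
    unfolding u(3) by (simp add: inner_add_right)
  moreover have "m \<bullet> x = (1 - u) * (m \<bullet> p') + u * (m \<bullet> q')"
    unfolding u' uu by (simp add: inner_add_right)
  ultimately have eq: "(1 - u) * (m \<bullet> p) + u * (m \<bullet> q) = (1 - u) * (m \<bullet> p') + u * (m \<bullet> q')"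
    by simp
  show False
  proof (cases "u = 0")
    case True
    then show False using eq lt by simp
  next
    case False
    then have "u * (m \<bullet> q) < u * (m \<bullet> q')" using u lt by simp
    moreover have "(1 - u) * (m \<bullet> p) \<le> (1 - u) * (m \<bullet> p')"
      using u lt by (intro mult_left_mono) auto
    ultimately show False using eq by simp
  qed
qed

text \<open>At equal parameters the two points have the same \<open>n\<close>-coordinate. Their
  \<open>m\<close>-difference is affine in the parameter and changes sign or vanishes at an end, so
  it has a zero.\<close>

lemma crossing_segments_meet:
  assumes row: "n \<bullet> p = \<alpha>" "n \<bullet> p' = \<alpha>" "n \<bullet> q = \<beta>" "n \<bullet> q' = \<beta>"
    and le: "m \<bullet> p \<le> m \<bullet> p'" "m \<bullet> q' \<le> m \<bullet> q"
  shows "closed_segment p q \<inter> closed_segment p' q' \<noteq> {}"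
proof (cases "m \<bullet> p = m \<bullet> p'")
  case True
  then have "p = p'" using row coords_eqI by simp
  then show ?thesis by auto
next
  case False
  \<comment> \<open>At parameter \<open>u\<close> the difference of the \<open>m\<close>-coordinates
    is \<open>(m \<bullet> p' - m \<bullet> p) - u * D\<close>, and \<open>u\<close> is chosen as
    its zero. Excluding a common endpoint in the first row makes \<open>D\<close> positive.\<close>
  define D where "D = (m \<bullet> p' - m \<bullet> p) + (m \<bullet> q - m \<bullet> q')"
  define u where "u = (m \<bullet> p' - m \<bullet> p) / D"
  have D: "D > 0" "m \<bullet> p' - m \<bullet> p \<le> D" using le False unfolding D_def by linarith+
  have u01: "0 \<le> u" "u \<le> 1" unfolding u_def using D le by (auto simp: divide_simps)
  have uD: "u * D = m \<bullet> p' - m \<bullet> p" unfolding u_def using D by simp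
  have "(1 - u) *\<^sub>R p + u *\<^sub>R q = (1 - u) *\<^sub>R p' + u *\<^sub>R q'"
  proof (rule coords_eqI)
    show "m \<bullet> ((1 - u) *\<^sub>R p + u *\<^sub>R q) = m \<bullet> ((1 - u) *\<^sub>R p' + u *\<^sub>R q')"
      using uD unfolding D_def by (simp add: inner_add_right algebra_simps)
    show "n \<bullet> ((1 - u) *\<^sub>R p + u *\<^sub>R q) = n \<bullet> ((1 - u) *\<^sub>R p' + u *\<^sub>R q')"
      using row by (simp add: inner_add_right)
  qed
  then show ?thesis using u01 unfolding closed_segment_def by blast
qed

text \<open>Along the segment \<open>n\<close> is affine and not constant, so it takes the value
  \<alpha> only at parameter 0.\<close>

lemma crossing_segment_row:
  assumes row: "n \<bullet> p = \<alpha>" "n \<bullet> q = \<beta>" "\<alpha> \<noteq> \<beta>" and x: "x \<in> closed_segment p q" "n \<bullet> x = \<alpha>"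
  shows "x = p"
proof -
  obtain u where u: "x = (1 - u) *\<^sub>R p + u *\<^sub>R q" using x by (auto simp: in_segment)
  have "n \<bullet> x = \<alpha> + u * (\<beta> - \<alpha>)"
    unfolding u by (simp add: inner_add_right row algebra_simps)
  then have "u = 0" using x(2) row(3) by simp
  then show ?thesis using u by simp
qed

section \<open>Noncrossing pairings and pairs of tilings\<close>

text \<open>For sets of equal size on the two lines this is the order-preserving matching. Ranks
  express it without enumerating the points.\<close>

definition rank_matching :: "(real ^ 2) set \<Rightarrow> (real ^ 2) set \<Rightarrow> (real ^ 2) set set" where
  "rank_matching P Q = {{p, q} | p q. p \<in> P \<and> q \<in> Q \<and>
     card {x\<in>P. m \<bullet> x < m \<bullet> p} = card {y\<in>Q. m \<bullet> y < m \<bullet> q}}"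

text \<open>The blocks inside a row form a tiling. The remaining blocks give a bijection
  \<open>h\<close> between the monomers, which preserves order because pairs out of order would
  meet; so it preserves ranks, and the tilings determine \<open>M\<close>.\<close>

lemma noncrossing_pairing_decomposition:
  assumes fin: "finite A" "finite B" and row: "A \<subseteq> {x. n \<bullet> x = \<alpha>}" "B \<subseteq> {x. n \<bullet> x = \<beta>}" "\<alpha> \<noteq> \<beta>"
    and M: "M \<in> noncrossing_pairings (A \<union> B)"
  defines "X \<equiv> {e \<in> M. e \<subseteq> A}" and "Y \<equiv> {e \<in> M. e \<subseteq> B}"
  shows "X \<in> adjacent_pairings A" "Y \<in> adjacent_pairings B"
    "card (A - \<Union>X) = card (B - \<Union>Y)" "M = X \<union> Y \<union> rank_matching (A - \<Union>X) (B - \<Union>Y)"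
proof -
  have AB: "A \<inter> B = {}" using row by auto
  note part = noncrossing_pairingsD(1)[OF M] and card2 = noncrossing_pairingsD(2)[OF M]
    and hulls = noncrossing_pairingsD(3)[OF M] and same = noncrossing_pairingsD(4)[OF M]
  \<comment> \<open>Every point of a row is an endpoint. A foreign point on the segment of
    \<open>e\<close> would lie on the segment of its own block as well.\<close>
  have hullM: "convex hull e \<inter> (A \<union> B) = e" if e: "e \<in> M" for e
  proof
    show "convex hull e \<inter> (A \<union> B) \<subseteq> e"
    proof
      fix x assume x: "x \<in> convex hull e \<inter> (A \<union> B)"
      then obtain f where f: "f \<in> M" "x \<in> f" using part by blast
      then have "x \<in> convex hull f" by (simp add: hull_inc)
      then have "e = f" using hulls[OF e f(1)] x by blast
      then show "x \<in> e" using f by simp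
    qed
    show "e \<subseteq> convex hull e \<inter> (A \<union> B)" using e part hull_subset[of e convex] by blast
  qed
  show "X \<in> adjacent_pairings A" "Y \<in> adjacent_pairings B"
  proof -
    have "disjoint M" using M unfolding noncrossing_pairings_def partition_on_def by blast
    then have "disjoint X" "disjoint Y"
      unfolding X_def Y_def by (simp_all add: pairwise_def)
    moreover have "convex hull e \<inter> A = e" if "e \<in> X" for e using hullM[of e] that unfolding X_def by blast
    moreover have "convex hull e \<inter> B = e" if "e \<in> Y" for e using hullM[of e] that unfolding Y_def by blast
    ultimately show "X \<in> adjacent_pairings A" "Y \<in> adjacent_pairings B"
      unfolding adjacent_pairings_def using card2 by (auto simp: X_def Y_def)
  qed
  let ?P = "A - \<Union>X" and ?Q = "B - \<Union>Y"
  let ?r = "\<lambda>P p. card {x\<in>P. m \<bullet> x < m \<bullet> p}"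
  have PA: "n \<bullet> p = \<alpha>" if "p \<in> ?P" for p using that row by blast
  have QB: "n \<bullet> q = \<beta>" if "q \<in> ?Q" for q using that row by blast
  have ne: "p \<noteq> q" if "p \<in> ?P" "q \<in> ?Q" for p q using that AB by blast
  have mono: "m \<bullet> p < m \<bullet> p' \<longleftrightarrow> m \<bullet> q < m \<bullet> q'"
    if pq: "p \<in> ?P" "q \<in> ?Q" "{p, q} \<in> M" "p' \<in> ?P" "q' \<in> ?Q" "{p', q'} \<in> M" for p q p' q'
  proof (cases "p = p' \<or> q = q'")
    case True
    then have "{p, q} = {p', q'}" using same pq by blast
    then show ?thesis using ne pq by (auto simp: doubleton_eq_iff)
  next
    case False
    then have "{p, q} \<noteq> {p', q'}" using ne pq by (auto simp: doubleton_eq_iff)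
    then have disj: "closed_segment p q \<inter> closed_segment p' q' = {}"
      using hulls pq unfolding segment_convex_hull by blast
    note meet = crossing_segments_meet[OF PA PA QB QB]
    show ?thesis
      using meet[of p p' q q'] meet[of p' p q' q] disj pq by (fastforce simp: Int_commute)
  qed
  have "\<forall>p\<in>?P. \<exists>q. q \<in> ?Q \<and> {p, q} \<in> M"
    using noncrossing_pairing_partner[OF M _ AB] unfolding X_def Y_def by blast
  then obtain h where h: "\<And>p. p \<in> ?P \<Longrightarrow> h p \<in> ?Q" "\<And>p. p \<in> ?P \<Longrightarrow> {p, h p} \<in> M"
    by metis
  have h_unique: "q = h p" if "p \<in> ?P" "q \<in> ?Q" "{p, q} \<in> M" for p q
  proof -
    have "{p, q} = {p, h p}" using same[of "{p, q}" "{p, h p}" p] that h by blast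
    then show ?thesis by (auto simp: doubleton_eq_iff)
  qed
  have inj: "inj_on h ?P"
  proof (rule inj_onI)
    fix p p' assume p: "p \<in> ?P" "p' \<in> ?P" "h p = h p'"
    then have "{p, h p} = {p', h p'}" 
      using same[OF h(2)[OF p(1)] h(2)[OF p(2)], of "h p"] by simp
    then show "p = p'" using p by (auto simp: doubleton_eq_iff)
  qed
  have surj: "h ` ?P = ?Q"
  proof
    show "?Q \<subseteq> h ` ?P"
    proof
      fix q assume q: "q \<in> ?Q"
      \<comment> \<open>The partner lemma is applied with the two rows exchanged.\<close>
      have "\<exists>p \<in> ?P. {q, p} \<in> M"
        using noncrossing_pairing_partner[of M B A q] M AB q unfolding X_def Y_def
        by (simp add: Un_commute Int_commute)
      then obtain p where "p \<in> ?P" "{p, q} \<in> M" by (metis insert_commute)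
      then show "q \<in> h ` ?P" using h_unique q by blast
    qed
  qed (use h in blast)
  show card_eq: "card ?P = card ?Q" using card_image[OF inj] surj by simp
  \<comment> \<open>\<open>h\<close> carries the monomers left of \<open>p\<close> bijectively to
    those left of \<open>h p\<close>.\<close>
  have rank: "?r ?Q (h p) = ?r ?P p" if p: "p \<in> ?P" for p
  proof -
    have "m \<bullet> x < m \<bullet> p \<longleftrightarrow> m \<bullet> h x < m \<bullet> h p" if x: "x \<in> ?P" for x
      by (rule mono[OF x h(1)[OF x] h(2)[OF x] p h(1)[OF p] h(2)[OF p]])
    then have "{y\<in>?Q. m \<bullet> y < m \<bullet> h p} = h ` {x\<in>?P. m \<bullet> x < m \<bullet> p}"
      unfolding surj[symmetric] by blast
    moreover have "inj_on h {x\<in>?P. m \<bullet> x < m \<bullet> p}"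
      by (rule inj_on_subset[OF inj]) blast
    ultimately show ?thesis by (simp add: card_image)
  qed
  have "finite ?Q" "inj_on ((\<bullet>) m) ?Q"
    using fin inj_on_row[of ?Q \<beta>] row(2) by auto
  then have inj_rank: "inj_on (?r ?Q) ?Q"
    by (rule bij_betw_imp_inj_on[OF bij_betw_rank])
  \<comment> \<open>The rank determines a point of \<open>?Q\<close>, so the rank matching contains
    no pairs beyond those given by \<open>h\<close>.\<close>
  have rank_unique: "q = h p" if "p \<in> ?P" "q \<in> ?Q" "?r ?P p = ?r ?Q q" for p q
    by (rule inj_onD[OF inj_rank _ that(2) h(1)[OF that(1)]]) (simp only: rank[OF that(1)] that(3))
  show "M = X \<union> Y \<union> rank_matching ?P ?Q"
  proof (intro equalityI subsetI)
    fix e assume e: "e \<in> M"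
    show "e \<in> X \<union> Y \<union> rank_matching ?P ?Q"
    proof (cases "e \<subseteq> A \<or> e \<subseteq> B")
      case True
      then show ?thesis using e unfolding X_def Y_def by blast
    next
      case False
      then obtain p q where pq: "p \<in> ?P" "q \<in> ?Q" "e = {p, q}"
        using noncrossing_pairing_mixed[OF M AB e] unfolding X_def Y_def by blast
      then have "q = h p" using h_unique e by blast
      then have "?r ?P p = ?r ?Q q" using rank[OF pq(1)] by simp
      then show ?thesis using pq unfolding rank_matching_def by blast
    qed
  next
    fix e assume "e \<in> X \<union> Y \<union> rank_matching ?P ?Q"
    then consider "e \<in> X \<union> Y" | "e \<in> rank_matching ?P ?Q" by blast
    then show "e \<in> M"
    proof cases
      case 2
      then obtain p q where pq: "p \<in> ?P" "q \<in> ?Q" "?r ?P p = ?r ?Q q" "e = {p, q}"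
        unfolding rank_matching_def by blast
      show ?thesis using h(2)[OF pq(1)] unfolding pq(4) rank_unique[OF pq(1-3)] .
    qed (auto simp: X_def Y_def)
  qed
qed

text \<open>The converse construction: two tilings with equally many monomers are completed by the
  rank matching. Disjointness of segments is checked for each combination of a dimer in the first
  row, a dimer in the second and a cross pair.\<close>

lemma rank_matching_noncrossing:
  assumes fin: "finite A" "finite B" and row: "A \<subseteq> {x. n \<bullet> x = \<alpha>}" "B \<subseteq> {x. n \<bullet> x = \<beta>}" "\<alpha> \<noteq> \<beta>"
    and X: "X \<in> adjacent_pairings A" and Y: "Y \<in> adjacent_pairings B"
    and card_eq: "card (A - \<Union>X) = card (B - \<Union>Y)"
  defines "M \<equiv> X \<union> Y \<union> rank_matching (A - \<Union>X) (B - \<Union>Y)"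
  shows "M \<in> noncrossing_pairings (A \<union> B)" "{e \<in> M. e \<subseteq> A} = X" "{e \<in> M. e \<subseteq> B} = Y"
proof -
  let ?P = "A - \<Union>X" and ?Q = "B - \<Union>Y"
  let ?R = "rank_matching ?P ?Q"
  let ?r = "\<lambda>P p. card {x\<in>P. m \<bullet> x < m \<bullet> p}"
  have AB: "A \<inter> B = {}" using row by auto
  have Xe: "card e = 2" "convex hull e \<inter> A = e" "e \<subseteq> A" if "e \<in> X" for e
    using X that unfolding adjacent_pairings_def by blast+
  have Ye: "card e = 2" "convex hull e \<inter> B = e" "e \<subseteq> B" if "e \<in> Y" for e
    using Y that unfolding adjacent_pairings_def by blast+
  have R: "\<exists>p q. e = {p, q} \<and> p \<in> ?P \<and> q \<in> ?Q \<and> ?r ?P p = ?r ?Q q" if "e \<in> ?R" for e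
    using that unfolding rank_matching_def by blast
  have finPQ: "finite ?P" "finite ?Q" using fin by auto
  \<comment> \<open>Equal numbers of monomers make both rank functions run through the same initial
    segment, so every monomer finds a partner.\<close>
  have bij: "bij_betw (?r ?P) ?P {..<card ?P}" "bij_betw (?r ?Q) ?Q {..<card ?P}"
    using bij_betw_rank[OF finPQ(1) inj_on_row[of ?P \<alpha>]]
      bij_betw_rank[OF finPQ(2) inj_on_row[of ?Q \<beta>]] row unfolding card_eq by blast+
  have partnerP: "\<exists>q\<in>?Q. ?r ?P p = ?r ?Q q" if "p \<in> ?P" for p
  proof -
    have "?r ?P p \<in> ?r ?Q ` ?Q"
      using bij_betw_apply[OF bij(1) that] bij_betw_imp_surj_on[OF bij(2)] by simp
    then show ?thesis by (simp only: image_iff)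
  qed
  have partnerQ: "\<exists>p\<in>?P. ?r ?P p = ?r ?Q q" if "q \<in> ?Q" for q
  proof -
    have "?r ?Q q \<in> ?r ?P ` ?P"
      using bij_betw_apply[OF bij(2) that] bij_betw_imp_surj_on[OF bij(1)] by simp
    then show ?thesis by (simp only: image_iff) metis
  qed
  have card2: "card e = 2" if "e \<in> M" for e
  proof -
    have "card e = 2" if eR: "e \<in> ?R"
    proof -
      obtain p q where "e = {p, q}" "p \<in> ?P" "q \<in> ?Q" using R[OF eR] by blast
      moreover have "p \<noteq> q" using calculation AB by blast
      ultimately show ?thesis by simp
    qed
    then show ?thesis using that Xe Ye unfolding M_def by blast
  qed
  have hullX: "convex hull e \<subseteq> {x. n \<bullet> x = \<alpha>}" if "e \<in> X" for e
    by (rule hull_minimal) (use Xe(3)[OF that] row convex_hyperplane in auto)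
  have hullY: "convex hull e \<subseteq> {x. n \<bullet> x = \<beta>}" if "e \<in> Y" for e
    by (rule hull_minimal) (use Ye(3)[OF that] row convex_hyperplane in auto)
  let ?nc = "\<lambda>e f. convex hull e \<inter> convex hull f = {}"
  have XX: "?nc e f" if "e \<in> X" "f \<in> X" "e \<noteq> f" for e f
    by (rule hulls_disjoint[OF row(1)]) (use that Xe X in \<open>auto simp: adjacent_pairings_def disjoint_def\<close>)
  have YY: "?nc e f" if "e \<in> Y" "f \<in> Y" "e \<noteq> f" for e f
    by (rule hulls_disjoint[OF row(2)]) (use that Ye Y in \<open>auto simp: adjacent_pairings_def disjoint_def\<close>)
  have XY: "?nc e f" if "e \<in> X" "f \<in> Y" for e f
    using hullX[OF that(1)] hullY[OF that(2)] row(3) by blast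
  \<comment> \<open>A cross pair meets the first line only in its monomer \<open>p\<close>, and a
    dimer's segment contains no point of \<open>A\<close> besides its ends.\<close>
  have XR: "?nc e f" if "e \<in> X" "f \<in> ?R" for e f
  proof -
    obtain p q where pq: "f = {p, q}" "p \<in> ?P" "q \<in> ?Q" using R[OF \<open>f \<in> ?R\<close>] by blast
    have "x = p" if "x \<in> convex hull e" "x \<in> closed_segment p q" for x
      by (rule crossing_segment_row[of p \<alpha> q \<beta>])
        (use pq row hullX[OF \<open>e \<in> X\<close>] that in blast)+
    moreover have "p \<notin> convex hull e" using Xe(2)[OF \<open>e \<in> X\<close>] \<open>e \<in> X\<close> pq by blast
    ultimately show ?thesis unfolding pq segment_convex_hull[symmetric] by blast
  qed
  have YR: "?nc e f" if "e \<in> Y" "f \<in> ?R" for e f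
  proof -
    obtain p q where pq: "f = {p, q}" "p \<in> ?P" "q \<in> ?Q" using R[OF \<open>f \<in> ?R\<close>] by blast
    have "x = q" if "x \<in> convex hull e" "x \<in> closed_segment q p" for x
      by (rule crossing_segment_row[of q \<beta> p \<alpha>])
        (use pq row hullY[OF \<open>e \<in> Y\<close>] that in blast)+
    moreover have "q \<notin> convex hull e" using Ye(2)[OF \<open>e \<in> Y\<close>] \<open>e \<in> Y\<close> pq by blast
    ultimately show ?thesis
      unfolding pq segment_convex_hull[symmetric] closed_segment_commute[of p] by blast
  qed
  \<comment> \<open>Equal ranks transfer the order from one row to the other, so distinct cross
    pairs are strictly ordered the same way at both ends.\<close>
  have RR: "?nc e f" if ef: "e \<in> ?R" "f \<in> ?R" "e \<noteq> f" for e f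
  proof -
    obtain p q where e: "e = {p, q}" "p \<in> ?P" "q \<in> ?Q" "?r ?P p = ?r ?Q q" using R[OF ef(1)] by blast
    obtain p' q' where f: "f = {p', q'}" "p' \<in> ?P" "q' \<in> ?Q" "?r ?P p' = ?r ?Q q'"
      using R[OF ef(2)] by blast
    have iff: "m \<bullet> p < m \<bullet> p' \<longleftrightarrow> m \<bullet> q < m \<bullet> q'" "m \<bullet> p' < m \<bullet> p \<longleftrightarrow> m \<bullet> q' < m \<bullet> q"
      using card_less_iff[OF finPQ(1), of p "(\<bullet>) m" p'] card_less_iff[OF finPQ(1), of p' "(\<bullet>) m" p]
        card_less_iff[OF finPQ(2), of q "(\<bullet>) m" q'] card_less_iff[OF finPQ(2), of q' "(\<bullet>) m" q] e f
      by simp_all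
    have rows: "n \<bullet> p = \<alpha>" "n \<bullet> p' = \<alpha>" "n \<bullet> q = \<beta>" "n \<bullet> q' = \<beta>" using e f row by blast+
    have "m \<bullet> p \<noteq> m \<bullet> p' \<or> m \<bullet> q \<noteq> m \<bullet> q'" using coords_eqI rows ef(3) e f by metis
    then consider "m \<bullet> p < m \<bullet> p'" "m \<bullet> q < m \<bullet> q'" | "m \<bullet> p' < m \<bullet> p" "m \<bullet> q' < m \<bullet> q"
      using iff by linarith
    then show ?thesis
    proof cases
      case 1
      then show ?thesis using crossing_segments_disjoint[OF rows row(3)]
        unfolding e f segment_convex_hull by blast
    next
      case 2
      then show ?thesis
        using crossing_segments_disjoint[OF rows(2) rows(1) rows(4) rows(3) row(3)]
        unfolding e f segment_convex_hull by blast
    qed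
  qed
  have hulls: "?nc e f" if "e \<in> M" "f \<in> M" "e \<noteq> f" for e f
    using that XX YY XY XY[of f e] XR XR[of f e] YR YR[of f e] RR
    unfolding M_def by (elim UnE) (simp_all add: Int_commute)
  have "disjoint M"
    unfolding disjoint_def
  proof (intro ballI impI)
    fix e f assume "e \<in> M" "f \<in> M" "e \<noteq> f"
    from hulls[OF this] show "e \<inter> f = {}"
      using hull_subset[of e convex] hull_subset[of f convex] by blast
  qed
  moreover have "\<Union>M = A \<union> B"
  proof
    show "\<Union>M \<subseteq> A \<union> B"
      using Xe(3) Ye(3) R unfolding M_def by blast
    show "A \<union> B \<subseteq> \<Union>M"
    proof
      fix x assume "x \<in> A \<union> B"
      then consider "x \<in> \<Union>X \<union> \<Union>Y" | "x \<in> ?P" | "x \<in> ?Q" by blast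
      then show "x \<in> \<Union>M"
      proof cases
        case 2
        then obtain q where "q \<in> ?Q" "?r ?P x = ?r ?Q q" using partnerP by blast
        then have "{x, q} \<in> M" using 2 unfolding M_def rank_matching_def by blast
        then show ?thesis by blast
      next
        case 3
        then obtain p where "p \<in> ?P" "?r ?P p = ?r ?Q x" using partnerQ by blast
        then have "{p, x} \<in> M" using 3 unfolding M_def rank_matching_def by blast
        then show ?thesis by blast
      qed (auto simp: M_def)
    qed
  qed
  moreover have "{} \<notin> M" using card2 by fastforce
  ultimately show "M \<in> noncrossing_pairings (A \<union> B)"
    using card2 hulls unfolding noncrossing_pairings_def partition_on_def by blast
  have nonempty: "e \<noteq> {}" if "e \<in> M" for e using \<open>{} \<notin> M\<close> that by blast
  \<comment> \<open>The rows are disjoint, so a dimer lies in its own row only and a cross pair in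
    neither; hence both tilings can be read off from \<open>M\<close>.\<close>
  have "\<not> e \<subseteq> B" if "e \<in> X" for e
    using Xe(3)[OF that] AB nonempty[of e] that unfolding M_def by blast
  moreover have "\<not> e \<subseteq> A" if "e \<in> Y" for e
    using Ye(3)[OF that] AB nonempty[of e] that unfolding M_def by blast
  moreover have "\<not> e \<subseteq> A \<and> \<not> e \<subseteq> B" if "e \<in> ?R" for e
    using R[OF that] AB by blast
  ultimately show "{e \<in> M. e \<subseteq> A} = X" "{e \<in> M. e \<subseteq> B} = Y"
    unfolding M_def using Xe(3) Ye(3) by blast+
qed

section \<open>The number of noncrossing pairings\<close>

text \<open>Pairings correspond to pairs of tilings with equally many monomers, which are sorted by
  their common number \<open>d\<close> of dimers. Summands with \<open>2 * d > k\<close> are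
  zero.\<close>

lemma card_noncrossing_pairings:
  assumes fin: "finite A" "finite B" and row: "A \<subseteq> {x. n \<bullet> x = \<alpha>}" "B \<subseteq> {x. n \<bullet> x = \<beta>}" "\<alpha> \<noteq> \<beta>"
    and k: "card A = k" "card B = k"
  shows "card (noncrossing_pairings (A \<union> B)) = (\<Sum>d\<le>k. ((k - d) choose d)\<^sup>2)"
proof -
  let ?Z = "{(X, Y). X \<in> adjacent_pairings A \<and> Y \<in> adjacent_pairings B
     \<and> card (A - \<Union>X) = card (B - \<Union>Y)}"
  let ?S = "\<lambda>A d. {X \<in> adjacent_pairings A. card X = d}"
  have "bij_betw (\<lambda>M. ({e \<in> M. e \<subseteq> A}, {e \<in> M. e \<subseteq> B})) (noncrossing_pairings (A \<union> B)) ?Z"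
    (is "bij_betw ?rows _ _")
  proof (rule bij_betw_byWitness[where
      f' = "\<lambda>(X, Y). X \<union> Y \<union> rank_matching (A - \<Union>X) (B - \<Union>Y)"])
    show "\<forall>M\<in>noncrossing_pairings (A \<union> B).
        (case ?rows M of (X, Y) \<Rightarrow> X \<union> Y \<union> rank_matching (A - \<Union>X) (B - \<Union>Y)) = M"
      using noncrossing_pairing_decomposition(4)[OF fin row] by simp
    show "\<forall>z\<in>?Z. ?rows (case z of (X, Y) \<Rightarrow> X \<union> Y \<union> rank_matching (A - \<Union>X) (B - \<Union>Y)) = z"
      using rank_matching_noncrossing(2,3)[OF fin row] by simp
    show "?rows ` noncrossing_pairings (A \<union> B) \<subseteq> ?Z"
      using noncrossing_pairing_decomposition(1-3)[OF fin row] by auto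
    show "(\<lambda>(X, Y). X \<union> Y \<union> rank_matching (A - \<Union>X) (B - \<Union>Y)) ` ?Z \<subseteq> noncrossing_pairings (A \<union> B)"
      using rank_matching_noncrossing(1)[OF fin row] by auto
  qed
  then have "card (noncrossing_pairings (A \<union> B)) = card ?Z" by (rule bij_betw_same_card)
  also have "?Z = (\<Union>d\<le>k. ?S A d \<times> ?S B d)"
  proof -
    \<comment> \<open>Each dimer uses two points of the row. As both rows have \<open>k\<close>
      points, equal numbers of monomers then mean equal numbers of dimers.\<close>
    have rest: "card (P - \<Union>X) = k - 2 * card X \<and> 2 * card X \<le> k"
      if "finite P" "card P = k" "X \<in> adjacent_pairings P" for P X
    proof -
      have sub: "\<Union>X \<subseteq> P" using that adjacent_pairings_subset by blast
      moreover have "card (\<Union>X) = 2 * card X" using card_Union_adjacent_pairing that by blast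
      moreover have "finite (\<Union>X)" using sub that(1) finite_subset by blast
      ultimately show ?thesis using that by (metis card_Diff_subset card_mono)
    qed
    have "card (A - \<Union>X) = card (B - \<Union>Y) \<longleftrightarrow> card X = card Y"
      if "X \<in> adjacent_pairings A" "Y \<in> adjacent_pairings B" for X Y
      using rest[OF fin(1) k(1) that(1)] rest[OF fin(2) k(2) that(2)] by auto
    moreover have "card Y \<le> k" if "Y \<in> adjacent_pairings B" for Y
      using rest[OF fin(2) k(2) that] by linarith
    ultimately show ?thesis by auto
  qed
  also have "card (\<Union>d\<le>k. ?S A d \<times> ?S B d) = (\<Sum>d\<le>k. card (?S A d \<times> ?S B d))"
    by (rule card_UN_disjoint) (use finite_adjacent_pairings(1) fin in auto)
  also have "\<dots> = (\<Sum>d\<le>k. ((k - d) choose d)\<^sup>2)"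
    using card_adjacent_pairings[OF fin(1) row(1)] card_adjacent_pairings[OF fin(2) row(2)] k
    by (simp only: card_cartesian_product power2_eq_square)
  finally show ?thesis .
qed

end

section \<open>Arbitrary parallel lines\<close>

text \<open>The first vector is \<open>n\<close> turned by a quarter. A difference
  \<open>x - y\<close> orthogonal to both has each coordinate annihilated by the squared length of
  \<open>n\<close>, which is nonzero.\<close>

lemma plane_coordinates_rotated:
  fixes n :: "real ^ 2"
  assumes "n \<noteq> 0"
  shows "plane_coordinates (vector [- (n $ 2), n $ 1]) n"
proof
  fix x y :: "real ^ 2"
  assume "vector [- (n $ 2), n $ 1] \<bullet> x = vector [- (n $ 2), n $ 1] \<bullet> y" "n \<bullet> x = n \<bullet> y"
  then have eq: "n $ 1 * (x $ 2 - y $ 2) = n $ 2 * (x $ 1 - y $ 1)"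
    "n $ 1 * (x $ 1 - y $ 1) + n $ 2 * (x $ 2 - y $ 2) = 0"
    by (simp_all add: inner_vec_def sum_2 algebra_simps)
  have "((n $ 1)\<^sup>2 + (n $ 2)\<^sup>2) * (x $ 1 - y $ 1) = 0" "((n $ 1)\<^sup>2 + (n $ 2)\<^sup>2) * (x $ 2 - y $ 2) = 0"
    using eq by algebra+
  moreover have "(n $ 1)\<^sup>2 + (n $ 2)\<^sup>2 \<noteq> 0"
    using assms by (simp add: vec_eq_iff forall_2 sum_power2_eq_zero_iff)
  ultimately show "x = y" by (auto simp: vec_eq_iff forall_2)
qed

theorem theorem6:
  fixes k :: nat and K L A B :: "(real ^ 2) set"
  assumes "affine K" and "aff_dim K = 1"
    and "affine L" and "aff_dim L = 1"
    and "affine_parallel K L" and "K \<noteq> L"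
    and "finite A" and "A \<subseteq> K" and "card A = k"
    and "finite B" and "B \<subseteq> L" and "card B = k"
  shows "num_level_paths k = card (noncrossing_pairings (A \<union> B))"
proof -
  \<comment> \<open>In the plane a line has codimension one, so it is a hyperplane and has a normal
    vector \<open>n\<close>.\<close>
  have "aff_dim K = DIM(real ^ 2) - 1" using assms(2) by simp
  then obtain n \<alpha> where n: "n \<noteq> 0" and "affine hull K = {x. n \<bullet> x = \<alpha>}"
    unfolding aff_dim_eq_hyperplane by blast
  then have K: "K = {x. n \<bullet> x = \<alpha>}" using assms(1) by (simp add: hull_same)
  obtain c where c: "L = (\<lambda>x. c + x) ` K"
    using assms(5) unfolding affine_parallel_def by blast
  \<comment> \<open>Translation by \<open>c\<close> shifts the level of \<open>n\<close> by
    \<open>n \<bullet> c\<close>, so both lines share the normal vector.\<close>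
  have L: "L = {x. n \<bullet> x = n \<bullet> c + \<alpha>}"
  proof (intro equalityI subsetI)
    fix x assume "x \<in> {x. n \<bullet> x = n \<bullet> c + \<alpha>}"
    then have "x - c \<in> K" by (simp add: K inner_diff_right)
    then show "x \<in> L" unfolding c by (rule rev_image_eqI) simp
  qed (auto simp: c K inner_add_right)
  interpret plane_coordinates "vector [- (n $ 2), n $ 1]" n
    by (rule plane_coordinates_rotated[OF n])
  have "\<alpha> \<noteq> n \<bullet> c + \<alpha>" using assms(6) K L by auto
  then show ?thesis
    using card_noncrossing_pairings[of A B \<alpha> "n \<bullet> c + \<alpha>" k] assms K L
    by (simp add: num_level_paths_eq)
qed

end
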